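(* Let $d>1$ and $1\le p\le d$ be integers. Then the expected decrease of the model-based iteration is given by $$\mathbb{E}_{\mathtt{mb}}[p,d]=\frac{\Gamma(d/2)\,\Gamma(p/2+1/2)}{\Gamma(d/2+1/2)\,\Gamma(p/2)}.$$
   Context: Let $1\le p\le d$ be integers. $\mathcal{S}^{d-1}$ is the Euclidean unit sphere in $\mathbb{R}^d$, and $\mathcal{V}_{p,d}=\{X\in\mathbb{R}^{d\times p}: X^{\mathrm T}X=I_p\}$ is the Stiefel manifold with its uniform distribution (the unique probability measure invariant under left multiplication by orthogonal $d\times d$ matrices). Let $g$ be uniformly distributed on $\mathcal{S}^{d-1}$ and let $B=[b_1\ \cdots\ b_p]$ be uniformly distributed on $\mathcal{V}_{p,d}$, with $g$ and $B$ independent. Put $f^{lin}(x)=g^{\mathrm T}x$. One model-based iteration in the random subspace, from a current iterate $x^k\in\mathbb{R}^d$ and with trust-region radius $\delta=1$, does the following. Let $f|_p(z)=f^{lin}(x^k+\sum_{i=1}^p z_ib_i)$ for $z\in\mathbb{R}^p$, and let $e_1,\dots,e_p$ be the canonical basis of $\mathbb{R}^p$. Form the simplex gradient $s\in\mathbb{R}^p$ of $f|_p$ at $0$, i.e. $s_i=f|_p(e_i)-f|_p(0)$ for $i=1,\dots,p$, and put $u=-s/\|s\|$ (Euclidean norm; $s\ne 0$ almost surely, and if $s=0$ one takes $x^{k+1}=x^k$). Let $z^*\in\{0,u\}$ be a minimizer of $f|_p$ over $\{0,u\}$ and set $x^{k+1}=x^k+\sum_{i=1}^p z_i^*b_i$.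 The expected decrease is $\mathbb{E}_{\mathtt{mb}}[p,d]:=\mathbb{E}[f^{lin}(x^k)-f^{lin}(x^{k+1})]$, the expectation being over $g$ and $B$. $\Gamma$ is the Gamma function. *)

theory Defs
  imports "HOL-Probability.Probability"
begin

text \<open>The uniform distributions on the unit sphere and on the Stiefel manifold are the unique Borel
  probability measures concentrated there that are invariant under left multiplication by
  orthogonal matrices; uniqueness makes these predicates determine the law.\<close>

definition uniform_on_sphere :: "(real^'d) measure \<Rightarrow> bool" where
  "uniform_on_sphere \<mu> \<longleftrightarrow>
     prob_space \<mu> \<and> sets \<mu> = sets borel \<and> emeasure \<mu> (sphere 0 1) = 1 \<and>
     (\<forall>Q :: real^'d^'d. orthogonal_matrix Q \<longrightarrow> distr \<mu> borel (\<lambda>v. Q *v v) = \<mu>)"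

text \<open>The type \<open>real^'p^'d\<close> consists of matrices with \<open>'d\<close> rows and \<open>'p\<close> columns.\<close>

definition stiefel :: "(real^'p^'d) set" where
  "stiefel = {X. transpose X ** X = mat 1}"

definition uniform_on_stiefel :: "(real^'p^'d) measure \<Rightarrow> bool" where
  "uniform_on_stiefel \<mu> \<longleftrightarrow>
     prob_space \<mu> \<and> sets \<mu> = sets borel \<and> emeasure \<mu> stiefel = 1 \<and>
     (\<forall>Q :: real^'d^'d. orthogonal_matrix Q \<longrightarrow> distr \<mu> borel (\<lambda>X. Q ** X) = \<mu>)"

definition f_lin :: "real^'d \<Rightarrow> real^'d \<Rightarrow> real" where
  "f_lin g x = g \<bullet> x"

definition subspace_point :: "real^'d \<Rightarrow> real^'p^'d \<Rightarrow> real^'p \<Rightarrow> real^'d" where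
  "subspace_point x B z = x + (\<Sum>i\<in>UNIV. z $ i *\<^sub>R column i B)"

definition simplex_gradient :: "(real^'p \<Rightarrow> real) \<Rightarrow> real^'p" where
  "simplex_gradient h = (\<chi> i. h (axis i 1) - h 0)"

text \<open>\<open>mb_step f x B x'\<close>: the point \<open>x'\<close> is a possible outcome of one model-based iteration
  for the objective \<open>f\<close>, started at \<open>x\<close> with trust-region radius 1, in the subspace spanned by
  the columns of \<open>B\<close>. It is a relation because any minimizer over the two candidates is allowed.\<close>

definition mb_step ::
  "(real^'d \<Rightarrow> real) \<Rightarrow> real^'d \<Rightarrow> real^'p^'d \<Rightarrow> real^'d \<Rightarrow> bool" where
  "mb_step f x B x' \<longleftrightarrow>
     (let h = (\<lambda>z. f (subspace_point x B z));
          s = simplex_gradient h;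
          u = - (s /\<^sub>R norm s)
      in if s = 0 then x' = x
         else \<exists>z\<in>{0, u}. (\<forall>w\<in>{0, u}. h z \<le> h w) \<and> x' = subspace_point x B z)"

lemma mb_step_exists: "\<exists>x'. mb_step f x B x'"
proof -
  have "\<exists>z\<in>{0, u}. \<forall>w\<in>{0, u}. h z \<le> h w" for h :: "real^'p \<Rightarrow> real" and u
    by (cases "h 0 \<le> h u") auto
  then show ?thesis
    unfolding mb_step_def Let_def by (metis (no_types, lifting))
qed

end

theory Submission
  imports Defs
begin

text \<open>
  For a linear objective the model is exact: the simplex gradient is \<open>s = g v* B\<close>, that is, the
  transpose of \<open>B\<close> applied to \<open>g\<close>, and the step decreases the objective by exactly \<open>norm s\<close>
  (\<open>mb_step_f_lin_decrease\<close>). So the claim is about the mean length of the coordinate vector of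
  the projection of a uniform unit vector onto the random subspace.

  This mean is the same for every fixed \<open>X\<close> with orthonormal columns, and it is obtained by
  averaging absolute inner products over a Gaussian weight. On \<open>n\<close>-dimensional space the integral of
  \<open>\<bar>y \<bullet> w\<bar> * exp (- (norm w)\<^sup>2)\<close> over \<open>w\<close> is \<open>a n * norm y\<close>, where \<open>a n = sqrt pi ^ (n - 1)\<close>. Let
  \<open>\<mu>\<close> be a sigma-finite rotation-invariant measure on \<open>d\<close>-dimensional space;
  the integral of \<open>\<bar>z \<bullet> v\<bar>\<close> over \<open>v\<close> is then \<open>\<kappa> * norm z\<close> with \<open>\<kappa>\<close> independent of \<open>z\<close>. Since \<open>(v v* X) \<bullet> w = v \<bullet> (X *v w)\<close> and
  \<open>norm (X *v w) = norm w\<close>, exchanging the two integrations gives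
  \<open>a p * (\<integral>v. norm (v v* X)) = \<kappa> * (\<integral>w. norm w * exp (- (norm w)\<^sup>2))\<close>, so that the integral of
  \<open>norm (v v* X)\<close> is \<open>\<kappa> * r p\<close> with \<open>r n = sqrt pi * Gamma (n / 2 + 1 / 2) / Gamma (n / 2)\<close>
  (\<open>nn_integral_norm_vector_stiefel_mult\<close>). When \<open>\<mu>\<close> is carried by the unit sphere, taking \<open>X\<close> to
  be the identity matrix gives \<open>1 = \<kappa> * r d\<close>. Hence the mean is \<open>r p / r d\<close>, as claimed. Neither
  the uniqueness of the uniform distribution nor any density of it is needed.
\<close>

section \<open>Radial integrals against Lebesgue measure\<close>

text \<open>The density of the squared norm is read off from the volume of balls. The squared norm is
  used rather than the norm because the radial Gaussian integrals then become Gamma integrals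
  without a change of variables.\<close>

lemma distr_lborel_norm_squared:
  "distr lborel borel (\<lambda>w :: 'a :: euclidean_space. (norm w)\<^sup>2) =
     density lborel (\<lambda>t. ennreal (pi powr (real DIM('a) / 2) / Gamma (real DIM('a) / 2)) *
       (indicator {0..} t * ennreal (t powr (real DIM('a) / 2 - 1))))"
    (is "?L = density lborel (\<lambda>t. ennreal ?c * ?d t)")
proof (rule measure_eqI_generator_eq[where E = "range atMost" and \<Omega> = UNIV
        and A = "\<lambda>n. {..real n}"])
  have n: "real DIM('a) / 2 > 0"
    by simp
  have c: "?c = real DIM('a) / 2 * unit_ball_vol (real DIM('a))"
  proof -
    have *: "Gamma (real DIM('a) / 2 + 1) = real DIM('a) / 2 * Gamma (real DIM('a) / 2)"
      using n by (intro Gamma_plus1) (metis nonpos_Ints_nonpos not_less)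
    show ?thesis
      unfolding unit_ball_vol_def * by simp
  qed
  have L: "emeasure ?L {..a} = (if a < 0 then 0 else
             ennreal (unit_ball_vol (real DIM('a)) * a powr (real DIM('a) / 2)))" for a
  proof (cases "a < 0")
    case True
    have "\<not> (norm w)\<^sup>2 \<le> a" for w :: 'a
      using True zero_le_power2[of "norm w"] by linarith
    then have "(\<lambda>w :: 'a. (norm w)\<^sup>2) -` {..a} = {}"
      by auto
    with True show ?thesis
      by (simp add: emeasure_distr)
  next
    case False
    have "(norm w)\<^sup>2 \<le> a \<longleftrightarrow> norm w \<le> sqrt a" for w :: 'a
      using real_sqrt_le_iff[of "(norm w)\<^sup>2" a] by simp
    then have "(\<lambda>w :: 'a. (norm w)\<^sup>2) -` {..a} = cball 0 (sqrt a)"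
      by auto
    moreover have "sqrt a ^ DIM('a) = a powr (real DIM('a) / 2)"
      using False
      by (cases "a = 0") (simp_all add: powr_half_sqrt[symmetric] powr_powr powr_realpow[symmetric])
    ultimately show ?thesis
      using False by (simp add: emeasure_distr emeasure_cball)
  qed
  show "emeasure ?L X = emeasure (density lborel (\<lambda>t. ennreal ?c * ?d t)) X" if "X \<in> range atMost" for X
  proof -
    obtain a where X: "X = {..a}"
      using \<open>X \<in> range atMost\<close> by auto
    have "emeasure (density lborel (\<lambda>t. ennreal ?c * ?d t)) {..a} =
            (\<integral>\<^sup>+t. ennreal ?c * (indicator {0..a} t * ennreal (t powr (real DIM('a) / 2 - 1))) \<partial>lborel)"
      by (subst emeasure_density) (auto intro!: nn_integral_cong simp: indicator_def)
    also have "\<dots> = ennreal ?c *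
            (\<integral>\<^sup>+t. indicator {0..a} t * ennreal (t powr (real DIM('a) / 2 - 1)) \<partial>lborel)"
      by (rule nn_integral_cmult) simp
    also have "\<dots> = emeasure ?L {..a}"
    proof (cases "a < 0")
      case True
      then show ?thesis by (simp add: L)
    next
      case False
      have "(\<integral>\<^sup>+t. indicator {0..a} t * ennreal (t powr (real DIM('a) / 2 - 1)) \<partial>lborel) =
              ennreal (a powr (real DIM('a) / 2) / (real DIM('a) / 2))"
        using nn_integral_has_integral_lebesgue[OF _ has_integral_powr_from_0[of "real DIM('a) / 2 - 1" a]] False n
        by (simp add: ennreal_mult' ennreal_indicator del: divide_pos_pos)
      then show ?thesis
        unfolding L c using False n by (simp add: ennreal_mult[symmetric] field_simps)
    qed
    finally show ?thesis
      by (simp add: X)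
  qed
  show "emeasure ?L {..real n} \<noteq> \<infinity>" for n
    by (simp add: L)
  show "sets ?L = sigma_sets UNIV (range atMost)"
    by (simp add: borel_eq_atMost[where 'a = real])
  show "sets (density lborel (\<lambda>t. ennreal ?c * ?d t)) = sigma_sets UNIV (range atMost)"
    by (simp add: borel_eq_atMost[where 'a = real])
  show "(\<Union>n. {..real n}) = (UNIV :: real set)"
    using real_arch_simple by blast
  have "{..a} \<inter> {..b} = {..min a b}" for a b :: real
    by auto
  then show "Int_stable (range atMost :: real set set)"
    by (auto simp: Int_stable_def)
qed auto

lemma nn_integral_norm_gaussian:
  shows "(\<integral>\<^sup>+(w :: 'a :: euclidean_space). ennreal ((norm w) ^ k * exp (- (norm w)\<^sup>2)) \<partial>lborel) =
     ennreal (pi powr (real DIM('a) / 2) / Gamma (real DIM('a) / 2) *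
       Gamma ((real DIM('a) + real k) / 2))"
proof -
  let ?c = "pi powr (real DIM('a) / 2) / Gamma (real DIM('a) / 2)"
  have "(\<integral>\<^sup>+(w :: 'a). ennreal ((norm w) ^ k * exp (- (norm w)\<^sup>2)) \<partial>lborel) =
        (\<integral>\<^sup>+t. ennreal (sqrt t ^ k * exp (- t)) \<partial>distr lborel borel (\<lambda>w :: 'a. (norm w)\<^sup>2))"
    by (subst nn_integral_distr) auto
  also have "\<dots> = (\<integral>\<^sup>+t. ennreal ?c *
      (indicator {0..} t * ennreal (t powr ((real DIM('a) + real k) / 2 - 1) / exp t)) \<partial>lborel)"
    unfolding distr_lborel_norm_squared
  proof (subst nn_integral_density, simp, simp, rule nn_integral_cong)
    fix t :: real
    have "t powr (real DIM('a) / 2 - 1) * sqrt t ^ k = t powr ((real DIM('a) + real k) / 2 - 1)" if "t > 0"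
    proof -
      have "sqrt t ^ k = t powr (real k / 2)"
        using that by (simp add: powr_half_sqrt[symmetric] powr_powr powr_realpow[symmetric])
      moreover have "real DIM('a) / 2 - 1 + real k / 2 = (real DIM('a) + real k) / 2 - 1"
        by (simp add: add_divide_distrib)
      ultimately show ?thesis
        by (metis powr_add)
    qed
    then have "t powr (real DIM('a) / 2 - 1) * (sqrt t ^ k * exp (- t)) =
        t powr ((real DIM('a) + real k) / 2 - 1) / exp t" if "t > 0"
      using that by (metis exp_minus divide_inverse mult.assoc)
    then show "ennreal ?c * (indicator {0..} t * ennreal (t powr (real DIM('a) / 2 - 1))) *
          ennreal (sqrt t ^ k * exp (- t)) =
        ennreal ?c * (indicator {0..} t *
          ennreal (t powr ((real DIM('a) + real k) / 2 - 1) / exp t))"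
      by (cases t "0 :: real" rule: linorder_cases) (simp_all add: mult.assoc ennreal_mult[symmetric])
  qed
  also have "\<dots> = ennreal ?c * ennreal (Gamma ((real DIM('a) + real k) / 2))"
  proof -
    have "(\<integral>\<^sup>+t. indicator {0..} t * ennreal (t powr ((real DIM('a) + real k) / 2 - 1) / exp t) \<partial>lborel) =
        (\<integral>\<^sup>+t. ennreal (indicator {0..} t * (t powr ((real DIM('a) + real k) / 2 - 1) / exp t)) \<partial>lborel)"
      by (intro nn_integral_cong) (simp add: indicator_def)
    also have "\<dots> = ennreal (Gamma ((real DIM('a) + real k) / 2))"
      by (rule nn_integral_has_integral_lebesgue[OF _ Gamma_integral_real]) (simp_all add: add_pos_nonneg)
    finally show ?thesis
      by (subst nn_integral_cmult) simp_all
  qed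
  also have "\<dots> = ennreal (?c * Gamma ((real DIM('a) + real k) / 2))"
    by (rule ennreal_mult[symmetric]) (simp_all add: less_imp_le[OF Gamma_real_pos] add_pos_nonneg)
  finally show ?thesis .
qed

lemma nn_integral_abs_inner_Basis_gaussian:
  fixes e :: "'a :: euclidean_space"
  assumes e: "e \<in> Basis"
  shows "(\<integral>\<^sup>+w. ennreal \<bar>e \<bullet> w\<bar> * ennreal (exp (- (norm w)\<^sup>2)) \<partial>lborel) =
           ennreal (sqrt pi ^ (DIM('a) - 1))"
proof -
  define f where "f b t = ennreal ((if b = e then \<bar>t\<bar> else 1) * exp (- t\<^sup>2))" for b :: 'a and t :: real
  have "ennreal \<bar>e \<bullet> w\<bar> * ennreal (exp (- (norm w)\<^sup>2)) = (\<Prod>b\<in>Basis. f b (w \<bullet> b))" for w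
  proof -
    have "(norm w)\<^sup>2 = (\<Sum>b\<in>Basis. (w \<bullet> b)\<^sup>2)"
      by (subst power2_norm_eq_inner, subst euclidean_inner) (simp add: power2_eq_square)
    then have "exp (- (norm w)\<^sup>2) = (\<Prod>b\<in>Basis. exp (- (w \<bullet> b)\<^sup>2))"
      by (simp add: exp_sum sum_negf[symmetric])
    moreover have "\<bar>e \<bullet> w\<bar> = (\<Prod>b\<in>Basis. if b = e then \<bar>w \<bullet> b\<bar> else 1)"
      using e by (simp add: inner_commute)
    ultimately show ?thesis
      unfolding f_def by (simp add: prod_ennreal ennreal_mult[symmetric] prod.distrib prod_nonneg
          del: prod.delta prod.delta')
  qed
  then have "(\<integral>\<^sup>+w. ennreal \<bar>e \<bullet> w\<bar> * ennreal (exp (- (norm w)\<^sup>2)) \<partial>lborel) =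
      (\<Prod>b\<in>Basis. (\<integral>\<^sup>+t. f b t \<partial>lborel))"
    using nn_integral_lborel_prod[of f] by (simp add: f_def[abs_def])
  also have "\<dots> = (\<Prod>b\<in>Basis. if b = e then 1 else ennreal (sqrt pi))"
  proof (rule prod.cong)
    have "Gamma (1 / 2 :: real) = sqrt pi"
      by (rule Gamma_one_half_real)
    \<comment> \<open>The one-dimensional integrals are the case \<open>'a = real\<close> of the radial formula.\<close>
    then show "(\<integral>\<^sup>+t. f b t \<partial>lborel) = (if b = e then 1 else ennreal (sqrt pi))" for b
      using nn_integral_norm_gaussian[where 'a = real, of 1] nn_integral_norm_gaussian[where 'a = real, of 0]
      by (auto simp: f_def powr_half_sqrt)
  qed simp
  also have "\<dots> = ennreal (sqrt pi ^ (DIM('a) - 1))"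
    using e by (subst prod.remove[of _ e]) (simp_all add: ennreal_power card_Diff_singleton
       cong: prod.cong_simp)
  finally show ?thesis .
qed

section \<open>Rotation-invariant measures\<close>

text \<open>Invariance under all orthogonal matrices, reflections included. The measure may be infinite,
  so that Lebesgue measure qualifies.\<close>

definition rotation_invariant :: "(real^'n) measure \<Rightarrow> bool" where
  "rotation_invariant \<mu> \<longleftrightarrow> sets \<mu> = sets borel \<and>
     (\<forall>Q :: real^'n^'n. orthogonal_matrix Q \<longrightarrow> distr \<mu> borel (\<lambda>v. Q *v v) = \<mu>)"

lemma borel_measurable_matrix_vector_mult [measurable]:
  fixes Q :: "real^'n^'m"
  shows "(\<lambda>v. Q *v v) \<in> borel_measurable borel"
  by (intro borel_measurable_continuous_onI linear_continuous_on matrix_vector_mul_bounded_linear)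

lemma borel_measurable_vector_matrix_mult [measurable]:
  fixes Q :: "real^'n^'m"
  shows "(\<lambda>v. v v* Q) \<in> borel_measurable borel"
  using borel_measurable_matrix_vector_mult[of "transpose Q"] by simp

lemma nn_integral_abs_inner_rotation_invariant:
  fixes a e :: "real^'n"
  assumes \<mu>: "rotation_invariant \<mu>" and e: "norm e = 1"
  shows "(\<integral>\<^sup>+v. ennreal \<bar>a \<bullet> v\<bar> \<partial>\<mu>) = ennreal (norm a) * (\<integral>\<^sup>+v. ennreal \<bar>e \<bullet> v\<bar> \<partial>\<mu>)"
proof -
  have [measurable_cong]: "sets \<mu> = sets borel"
    using \<mu> by (simp add: rotation_invariant_def)
  obtain f where f: "orthogonal_transformation f" "f a = norm a *\<^sub>R e"
    using orthogonal_transformation_exists[of a "norm a *\<^sub>R e"] e by auto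
  define Q where "Q = matrix f"
  have Q: "orthogonal_matrix Q" "Q *v a = norm a *\<^sub>R e"
    using f orthogonal_transformation_matrix[of f] by (auto simp: Q_def matrix_works)
  have "distr \<mu> borel (\<lambda>v. transpose Q *v v) = \<mu>"
    using \<mu> Q(1) by (simp add: rotation_invariant_def del: transpose_matrix_vector)
  then have "(\<integral>\<^sup>+v. ennreal \<bar>a \<bullet> v\<bar> \<partial>\<mu>) = (\<integral>\<^sup>+v. ennreal \<bar>a \<bullet> v\<bar> \<partial>distr \<mu> borel (\<lambda>v. v v* Q))"
    by simp
  also have "\<dots> = (\<integral>\<^sup>+v. ennreal \<bar>(Q *v a) \<bullet> v\<bar> \<partial>\<mu>)"
    by (subst nn_integral_distr) (simp_all add: inner_commute[of a] dot_lmul_matrix inner_commute[of _ "Q *v a"])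
  also have "\<dots> = (\<integral>\<^sup>+v. ennreal (norm a) * ennreal \<bar>e \<bullet> v\<bar> \<partial>\<mu>)"
    by (simp add: Q(2) abs_mult ennreal_mult)
  finally show ?thesis
    by (simp add: nn_integral_cmult)
qed

lemma nn_integral_lborel_translate:
  fixes c :: "'a :: euclidean_space"
  assumes "f \<in> borel_measurable borel"
  shows "(\<integral>\<^sup>+x. f (c + x) \<partial>lborel) = (\<integral>\<^sup>+x. f x \<partial>lborel)"
  using assms nn_integral_distr[of "(+) c" lborel borel f] by (simp add: lborel_distr_plus)

text \<open>Invariance of Lebesgue measure follows from its translation invariance, by the argument that
  proves Haar measure unique. For a Borel set \<open>A\<close> with indicator function \<open>?A\<close> and the indicator
  function \<open>B\<close> of the unit ball, integrate \<open>?A (Q *v x) * B (Q *v x - y)\<close> over \<open>x\<close> and \<open>y\<close>. Over \<open>y\<close>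
  first, this gives the measure of the preimage of \<open>A\<close> times the volume \<open>c\<close> of the ball. Since \<open>Q\<close>
  preserves norms, translating \<open>x\<close> by the preimage \<open>y v* Q\<close> of \<open>y\<close> turns the integrand into
  \<open>?A (Q *v x + y) * B x\<close>, whose integral is the measure of \<open>A\<close> times \<open>c\<close>.\<close>

lemma rotation_invariant_lborel: "rotation_invariant (lborel :: (real^'n) measure)"
  unfolding rotation_invariant_def
proof safe
  fix Q :: "real^'n^'n"
  assume Q: "orthogonal_matrix Q"
  have QT: "Q *v (y v* Q) = y" for y
  proof -
    have "Q *v (transpose Q *v y) = y"
      using Q by (simp add: matrix_vector_mul_assoc orthogonal_matrix_def del: transpose_matrix_vector)
    then show ?thesis
      by simp
  qed
  have norm_Q: "norm (Q *v w) = norm w" for w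
    using Q by (simp add: orthogonal_transformation_matrix orthogonal_transformation_norm)
  define B :: "real^'n \<Rightarrow> ennreal" where "B y = indicator {..<1} (norm y)" for y
  define c where "c = (\<integral>\<^sup>+y. B y \<partial>lborel)"
  have [measurable]: "B \<in> borel_measurable borel"
    unfolding B_def[abs_def] by measurable
  have B_translate: "(\<integral>\<^sup>+y. B (z - y) \<partial>lborel) = c" for z
  proof -
    have "(\<integral>\<^sup>+y. B (z - y) \<partial>lborel) = (\<integral>\<^sup>+y. B (- z + y) \<partial>lborel)"
      by (intro nn_integral_cong) (simp add: B_def norm_minus_commute)
    also have "\<dots> = c"
      unfolding c_def by (rule nn_integral_lborel_translate) measurable
    finally show ?thesis .
  qed
  have "B = indicator (ball 0 1)"
    by (auto simp: B_def indicator_def)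
  then have "c = emeasure lborel (ball 0 1 :: (real^'n) set)"
    by (simp add: c_def)
  then have c: "c \<noteq> 0" "c \<noteq> top"
    using unit_ball_vol_pos[of "real CARD('n)"] by (simp_all add: emeasure_ball less_imp_neq[symmetric] del: unit_ball_vol_pos)
  show "distr lborel borel ((*v) Q) = lborel"
  proof (rule measure_eqI)
    fix A
    assume "A \<in> sets (distr lborel borel ((*v) Q))"
    then have [measurable]: "A \<in> sets borel"
      by simp
    let ?A = "indicator A :: real^'n \<Rightarrow> ennreal"
    have "emeasure (distr lborel borel ((*v) Q)) A * c =
        (\<integral>\<^sup>+x. ?A (Q *v x) \<partial>lborel) * c"
      by (subst nn_integral_indicator[symmetric], simp, subst nn_integral_distr) auto
    also have "\<dots> = (\<integral>\<^sup>+x. \<integral>\<^sup>+y. ?A (Q *v x) * B (Q *v x - y) \<partial>lborel \<partial>lborel)"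
    proof -
      have "(\<integral>\<^sup>+y. ?A (Q *v x) * B (Q *v x - y) \<partial>lborel) =
          ?A (Q *v x) * c" for x
        by (subst nn_integral_cmult) (simp_all add: B_translate)
      then show ?thesis
        by (simp add: nn_integral_multc)
    qed
    also have "\<dots> = (\<integral>\<^sup>+y. \<integral>\<^sup>+x. ?A (Q *v x) * B (Q *v x - y) \<partial>lborel \<partial>lborel)"
      by (rule lborel_pair.Fubini') measurable
    also have "\<dots> = (\<integral>\<^sup>+y. \<integral>\<^sup>+x. ?A (Q *v x + y) * B x \<partial>lborel \<partial>lborel)"
    proof (rule nn_integral_cong)
      fix y
      have "(\<integral>\<^sup>+x. ?A (Q *v x) * B (Q *v x - y) \<partial>lborel) =
          (\<integral>\<^sup>+x. ?A (Q *v (y v* Q + x)) * B (Q *v (y v* Q + x) - y) \<partial>lborel)"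
        by (rule nn_integral_lborel_translate[symmetric]) measurable
      also have "\<dots> = (\<integral>\<^sup>+x. ?A (Q *v x + y) * B x \<partial>lborel)"
        by (simp add: matrix_vector_right_distrib QT add.commute B_def norm_Q)
      finally show "(\<integral>\<^sup>+x. ?A (Q *v x) * B (Q *v x - y) \<partial>lborel) =
          (\<integral>\<^sup>+x. ?A (Q *v x + y) * B x \<partial>lborel)" .
    qed
    also have "\<dots> = (\<integral>\<^sup>+x. \<integral>\<^sup>+y. ?A (Q *v x + y) * B x \<partial>lborel \<partial>lborel)"
      by (rule lborel_pair.Fubini') measurable
    also have "\<dots> = emeasure lborel A * c"
      by (simp add: nn_integral_multc nn_integral_lborel_translate[of ?A] nn_integral_cmult c_def)
    finally have "emeasure (distr lborel borel ((*v) Q)) A * c =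
        emeasure lborel A * c" .
    with c show "emeasure (distr lborel borel ((*v) Q)) A = emeasure lborel A"
      by (metis ennreal_mult_divide_eq)
  qed simp
qed auto

lemma rotation_invariant_density_norm:
  fixes \<mu> :: "(real^'n) measure"
  assumes \<mu>: "rotation_invariant \<mu>" and [measurable]: "f \<in> borel_measurable borel"
  shows "rotation_invariant (density \<mu> (\<lambda>w. f (norm w)))"
  unfolding rotation_invariant_def
proof (intro conjI allI impI)
  have [measurable_cong]: "sets \<mu> = sets borel"
    using \<mu> by (simp add: rotation_invariant_def)
  show "sets (density \<mu> (\<lambda>w. f (norm w))) = sets borel"
    using \<mu> by (simp add: rotation_invariant_def)
  fix Q :: "real^'n^'n"
  assume Q: "orthogonal_matrix Q"
  have "norm (Q *v w) = norm w" for w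
    using Q by (simp add: orthogonal_transformation_matrix orthogonal_transformation_norm)
  then have "distr (density \<mu> (\<lambda>w. f (norm w))) borel ((*v) Q) =
      distr (density \<mu> (\<lambda>w. f (norm (Q *v w)))) borel ((*v) Q)"
    by simp
  also have "\<dots> = density (distr \<mu> borel ((*v) Q)) (\<lambda>w. f (norm w))"
    by (subst density_distr) simp_all
  also have "distr \<mu> borel ((*v) Q) = \<mu>"
    using \<mu> Q by (simp add: rotation_invariant_def)
  finally show "distr (density \<mu> (\<lambda>w. f (norm w))) borel ((*v) Q) = density \<mu> (\<lambda>w. f (norm w))" .
qed

lemma nn_integral_abs_inner_gaussian:
  fixes y :: "real^'n"
  shows "(\<integral>\<^sup>+w. ennreal \<bar>y \<bullet> w\<bar> * ennreal (exp (- (norm w)\<^sup>2)) \<partial>lborel) =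
           ennreal (sqrt pi ^ (CARD('n) - 1)) * ennreal (norm y)"
proof -
  obtain e :: "real^'n" where e: "e \<in> Basis"
    using nonempty_Basis by blast
  have "rotation_invariant (density lborel (\<lambda>w :: real^'n. ennreal (exp (- (norm w)\<^sup>2))))"
    using rotation_invariant_density_norm[OF rotation_invariant_lborel, of "\<lambda>r. ennreal (exp (- r\<^sup>2))"]
    by simp
  from nn_integral_abs_inner_rotation_invariant[OF this norm_Basis[OF e], of y]
  show ?thesis
    using nn_integral_abs_inner_Basis_gaussian[OF e]
    by (simp add: nn_integral_density mult.commute)
qed

section \<open>Norm of the projection onto a random subspace\<close>

lemma norm_stiefel_mult:
  fixes X :: "real^'p^'d"
  assumes "X \<in> stiefel"
  shows "norm (X *v w) = norm w"
proof -
  have "(X *v w) \<bullet> (X *v w) = (transpose X *v (X *v w)) \<bullet> w"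
    by (simp add: dot_lmul_matrix)
  also have "transpose X *v (X *v w) = w"
    using assms by (simp add: stiefel_def matrix_vector_mul_assoc del: transpose_matrix_vector)
  finally show ?thesis
    by (simp add: norm_eq)
qed

lemma nn_integral_norm_times_gaussian:
  "(\<integral>\<^sup>+(w :: real^'n). ennreal (norm w * exp (- (norm w)\<^sup>2)) \<partial>lborel) =
     ennreal (sqrt pi ^ (CARD('n) - 1)) *
     ennreal (sqrt pi * Gamma (real CARD('n) / 2 + 1 / 2) / Gamma (real CARD('n) / 2))"
proof -
  have "pi powr (real CARD('n) / 2) = sqrt pi ^ CARD('n)"
    by (simp add: powr_half_sqrt[symmetric] powr_powr powr_realpow[symmetric])
  also have "\<dots> = sqrt pi ^ (CARD('n) - 1) * sqrt pi"
    by (simp add: power_minus_mult del: One_nat_def)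
  finally have "pi powr (real CARD('n) / 2) / Gamma (real CARD('n) / 2) * Gamma ((real CARD('n) + 1) / 2) =
      sqrt pi ^ (CARD('n) - 1) * (sqrt pi * Gamma (real CARD('n) / 2 + 1 / 2) / Gamma (real CARD('n) / 2))"
    by (simp add: add_divide_distrib)
  then show ?thesis
    using nn_integral_norm_gaussian[where 'a = "real^'n", of 1]
    by (simp add: ennreal_mult'[symmetric])
qed

text \<open>The projected length, computed up to the factor \<open>\<kappa>\<close> by writing it as a Gaussian average of
  absolute inner products and exchanging the integrations.\<close>

lemma nn_integral_norm_vector_stiefel_mult:
  fixes X :: "real^'p^'d" and e :: "real^'d"
  assumes \<mu>: "rotation_invariant \<mu>" and sf: "sigma_finite_measure \<mu>"
    and X: "X \<in> stiefel" and e: "norm e = 1"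
  shows "(\<integral>\<^sup>+v. ennreal (norm (v v* X)) \<partial>\<mu>) =
     ennreal (sqrt pi * Gamma (real CARD('p) / 2 + 1 / 2) / Gamma (real CARD('p) / 2)) *
     (\<integral>\<^sup>+v. ennreal \<bar>e \<bullet> v\<bar> \<partial>\<mu>)" (is "?E = ennreal ?r * ?\<kappa>")
proof -
  have [measurable_cong]: "sets \<mu> = sets borel"
    using \<mu> by (simp add: rotation_invariant_def)
  interpret \<mu>: sigma_finite_measure \<mu> by fact
  interpret pair_sigma_finite \<mu> "lborel :: (real^'p) measure" ..
  let ?G = "\<lambda>w :: real^'p. ennreal (exp (- (norm w)\<^sup>2))"
  let ?a = "ennreal (sqrt pi ^ (CARD('p) - 1))"
  have "?a * ?E = (\<integral>\<^sup>+v. \<integral>\<^sup>+w. ennreal \<bar>(v v* X) \<bullet> w\<bar> * ?G w \<partial>lborel \<partial>\<mu>)"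
    by (subst nn_integral_cmult[symmetric]) (simp_all add: nn_integral_abs_inner_gaussian)
  also have "\<dots> = (\<integral>\<^sup>+w. \<integral>\<^sup>+v. ennreal \<bar>(v v* X) \<bullet> w\<bar> * ?G w \<partial>\<mu> \<partial>lborel)"
    by (rule Fubini'[symmetric]) measurable
  also have "\<dots> = (\<integral>\<^sup>+w. \<integral>\<^sup>+v. ?G w * ennreal \<bar>(X *v w) \<bullet> v\<bar> \<partial>\<mu> \<partial>lborel)"
    by (simp only: dot_lmul_matrix inner_commute[of _ "X *v _"] mult.commute)
  also have "\<dots> = (\<integral>\<^sup>+(w :: real^'p). ennreal (norm w * exp (- (norm w)\<^sup>2)) * ?\<kappa> \<partial>lborel)"
  proof (rule nn_integral_cong)
    fix w :: "real^'p"
    have "(\<integral>\<^sup>+v. ?G w * ennreal \<bar>(X *v w) \<bullet> v\<bar> \<partial>\<mu>) = ?G w * (\<integral>\<^sup>+v. ennreal \<bar>(X *v w) \<bullet> v\<bar> \<partial>\<mu>)"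
      by (rule nn_integral_cmult) measurable
    also have "(\<integral>\<^sup>+v. ennreal \<bar>(X *v w) \<bullet> v\<bar> \<partial>\<mu>) = ennreal (norm w) * ?\<kappa>"
      using nn_integral_abs_inner_rotation_invariant[OF \<mu> e, of "X *v w"]
      unfolding norm_stiefel_mult[OF X] .
    also have "?G w * (ennreal (norm w) * ?\<kappa>) = (ennreal (norm w) * ?G w) * ?\<kappa>"
      by (simp only: mult_ac)
    also have "ennreal (norm w) * ?G w = ennreal (norm w * exp (- (norm w)\<^sup>2))"
      by (simp only: ennreal_mult norm_ge_zero exp_ge_zero)
    finally show "(\<integral>\<^sup>+v. ?G w * ennreal \<bar>(X *v w) \<bullet> v\<bar> \<partial>\<mu>) =
        ennreal (norm w * exp (- (norm w)\<^sup>2)) * ?\<kappa>" .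
  qed
  also have "\<dots> = (\<integral>\<^sup>+(w :: real^'p). ennreal (norm w * exp (- (norm w)\<^sup>2)) \<partial>lborel) * ?\<kappa>"
    by (rule nn_integral_multc) measurable
  also have "\<dots> = ?a * (ennreal ?r * ?\<kappa>)"
    by (simp only: nn_integral_norm_times_gaussian mult.assoc)
  finally have "?a * ?E = ?a * (ennreal ?r * ?\<kappa>)" .
  then have "(?E * ?a) / ?a = (ennreal ?r * ?\<kappa> * ?a) / ?a"
    by (simp only: mult.commute)
  then show ?thesis
    by (simp add: ennreal_mult_divide_eq)
qed

lemma nn_integral_norm_vector_stiefel_mult_sphere:
  fixes X :: "real^'p^'d"
  assumes \<mu>: "uniform_on_sphere \<mu>" and X: "X \<in> stiefel"
  shows "(\<integral>\<^sup>+v. ennreal (norm (v v* X)) \<partial>\<mu>) =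
           ennreal (Gamma (real CARD('d) / 2) * Gamma (real CARD('p) / 2 + 1 / 2) /
             (Gamma (real CARD('d) / 2 + 1 / 2) * Gamma (real CARD('p) / 2)))"
proof -
  interpret prob_space \<mu>
    using \<mu> by (simp add: uniform_on_sphere_def)
  have \<mu>': "rotation_invariant \<mu>" and sets: "sets \<mu> = sets borel"
    using \<mu> by (simp_all add: uniform_on_sphere_def rotation_invariant_def)
  have sf: "sigma_finite_measure \<mu>" ..
  obtain e :: "real^'d" where e: "norm e = 1"
    using norm_axis_1 by blast
  define \<kappa> where "\<kappa> = (\<integral>\<^sup>+v. ennreal \<bar>e \<bullet> v\<bar> \<partial>\<mu>)"
  define r :: "real \<Rightarrow> real" where "r n = sqrt pi * Gamma (n / 2 + 1 / 2) / Gamma (n / 2)" for n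
  have r_pos: "r n > 0" if "n > 0" for n
    using that by (simp add: r_def add_pos_pos)
  have "AE v in \<mu>. v \<in> sphere 0 1"
    using \<mu> sets by (subst AE_in_set_eq_1) (auto simp: uniform_on_sphere_def emeasure_eq_measure)
  then have "AE v in \<mu>. ennreal (norm v) = 1"
    by eventually_elim simp
  then have "(\<integral>\<^sup>+v. ennreal (norm v) \<partial>\<mu>) = (\<integral>\<^sup>+v. 1 \<partial>\<mu>)"
    by (rule nn_integral_cong_AE)
  then have "(\<integral>\<^sup>+v. ennreal (norm v) \<partial>\<mu>) = 1"
    by (simp add: emeasure_space_1)
  moreover have "(\<integral>\<^sup>+v. ennreal (norm v) \<partial>\<mu>) = ennreal (r CARD('d)) * \<kappa>"
    using nn_integral_norm_vector_stiefel_mult[OF \<mu>' sf _ e, of "mat 1 :: real^'d^'d"]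
    by (simp add: stiefel_def \<kappa>_def r_def)
  \<comment> \<open>The identity matrix, for which the projected length is the norm of \<open>v\<close>, determines \<open>\<kappa>\<close>.\<close>
  ultimately have "1 / ennreal (r CARD('d)) = \<kappa> * ennreal (r CARD('d)) / ennreal (r CARD('d))"
    by (simp add: mult.commute)
  then have \<kappa>: "\<kappa> = ennreal (1 / r CARD('d))"
    using r_pos[of "CARD('d)"] by (simp add: ennreal_mult_divide_eq divide_ennreal[symmetric])
  have "(\<integral>\<^sup>+v. ennreal (norm (v v* X)) \<partial>\<mu>) = ennreal (r CARD('p)) * \<kappa>"
    using nn_integral_norm_vector_stiefel_mult[OF \<mu>' sf X e] by (simp add: \<kappa>_def r_def)
  also have "\<dots> = ennreal (r CARD('p) / r CARD('d))"
    using r_pos[of "CARD('p)"] r_pos[of "CARD('d)"] by (simp add: \<kappa> ennreal_mult[symmetric])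
  also have "r CARD('p) / r CARD('d) =
      Gamma (real CARD('d) / 2) * Gamma (real CARD('p) / 2 + 1 / 2) /
        (Gamma (real CARD('d) / 2 + 1 / 2) * Gamma (real CARD('p) / 2))"
    by (simp add: r_def mult.commute)
  finally show ?thesis .
qed

section \<open>The decrease of a model-based step\<close>

lemma f_lin_subspace_point: "f_lin g (subspace_point x B z) = f_lin g x + (g v* B) \<bullet> z"
proof -
  have "subspace_point x B z = x + B *v z"
    by (simp add: subspace_point_def matrix_mult_sum scalar_mult_eq_scaleR)
  then show ?thesis
    by (simp add: f_lin_def inner_add_right dot_lmul_matrix)
qed

lemma mb_step_f_lin_decrease:
  assumes "mb_step (f_lin g) x B x'"
  shows "f_lin g x - f_lin g x' = norm (g v* B)"
proof -
  define s where "s = g v* B"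
  define u where "u = - (s /\<^sub>R norm s)"
  have f_lin: "f_lin g (subspace_point x B z) = f_lin g x + s \<bullet> z" for z
    by (simp add: f_lin_subspace_point s_def)
  have gradient: "simplex_gradient (\<lambda>z. f_lin g x + s \<bullet> z) = s"
    by (simp add: simplex_gradient_def inner_axis vec_eq_iff)
  have step: "if s = 0 then x' = x else
      \<exists>z\<in>{0, u}. (\<forall>w\<in>{0, u}. s \<bullet> z \<le> s \<bullet> w) \<and> x' = subspace_point x B z"
    using assms unfolding mb_step_def Let_def f_lin gradient u_def[symmetric] add_le_cancel_left .
  show ?thesis
  proof (cases "s = 0")
    case True
    with step show ?thesis
      by (simp add: s_def)
  next
    case False
    have "s \<bullet> u = - norm s"
      using False by (simp add: u_def power2_norm_eq_inner[symmetric] power2_eq_square)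
    moreover obtain z where "z \<in> {0, u}" "\<forall>w\<in>{0, u}. s \<bullet> z \<le> s \<bullet> w"
      and x': "x' = subspace_point x B z"
      using step by (metis False)
    ultimately have "s \<bullet> z = - norm s"
      using False by auto
    then show ?thesis
      by (simp add: x' f_lin_subspace_point s_def)
  qed
qed

text \<open>The two variables may take values in different types, which \<open>indep_var\<close> does not allow.\<close>

lemma (in prob_space) distr_pair_eq_pair_measure:
  assumes X [measurable]: "random_variable S X" and Y [measurable]: "random_variable T Y"
    and indep: "indep_set {X -` A \<inter> space M | A. A \<in> sets S} {Y -` A \<inter> space M | A. A \<in> sets T}"
  shows "distr M S X \<Otimes>\<^sub>M distr M T Y = distr M (S \<Otimes>\<^sub>M T) (\<lambda>\<omega>. (X \<omega>, Y \<omega>))"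
proof (rule pair_measure_eqI)
  interpret X: prob_space "distr M S X" by (rule prob_space_distr) measurable
  interpret Y: prob_space "distr M T Y" by (rule prob_space_distr) measurable
  show "sigma_finite_measure (distr M S X)" "sigma_finite_measure (distr M T Y)" ..
  show "sets (distr M S X \<Otimes>\<^sub>M distr M T Y) = sets (distr M (S \<Otimes>\<^sub>M T) (\<lambda>\<omega>. (X \<omega>, Y \<omega>)))"
    unfolding sets_distr by (rule sets_pair_measure_cong) simp_all
  fix A C
  assume "A \<in> sets (distr M S X)" "C \<in> sets (distr M T Y)"
  then have A [measurable]: "A \<in> sets S" and C [measurable]: "C \<in> sets T"
    by simp_all
  have "(\<lambda>\<omega>. (X \<omega>, Y \<omega>)) -` (A \<times> C) \<inter> space M = (X -` A \<inter> space M) \<inter> (Y -` C \<inter> space M)"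
    by auto
  moreover have "prob ((X -` A \<inter> space M) \<inter> (Y -` C \<inter> space M)) =
      prob (X -` A \<inter> space M) * prob (Y -` C \<inter> space M)"
    using indep A C by (intro indep_setD) auto
  ultimately show "emeasure (distr M S X) A * emeasure (distr M T Y) C =
      emeasure (distr M (S \<Otimes>\<^sub>M T) (\<lambda>\<omega>. (X \<omega>, Y \<omega>))) (A \<times> C)"
    by (simp add: emeasure_distr emeasure_eq_measure ennreal_mult)
qed

lemma borel_measurable_vector_matrix_mult_pair [measurable]:
  "(\<lambda>(v, X). v v* X) \<in> borel_measurable (borel \<Otimes>\<^sub>M (borel :: (real^'p^'d) measure))"
  unfolding borel_prod vector_matrix_mult_def split_def
  by (intro borel_measurable_continuous_onI continuous_intros)

theorem theorem4p2:
  fixes M :: "'a measure"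
    and g :: "'a \<Rightarrow> real^'d"
    and B :: "'a \<Rightarrow> real^'p^'d"
    and x :: "real^'d"
    and x_next :: "'a \<Rightarrow> real^'d"
  assumes "CARD('d) > 1" and "1 \<le> CARD('p)" and "CARD('p) \<le> CARD('d)"
    and "prob_space M"
    and "g \<in> borel_measurable M" and "uniform_on_sphere (distr M borel g)"
    and "B \<in> borel_measurable M" and "uniform_on_stiefel (distr M borel B)"
    and "prob_space.indep_set M {g -` S \<inter> space M | S. S \<in> sets borel}
                                {B -` S \<inter> space M | S. S \<in> sets borel}"
    and "\<And>\<omega>. \<omega> \<in> space M \<Longrightarrow> mb_step (f_lin (g \<omega>)) x (B \<omega>) (x_next \<omega>)"
  shows "prob_space.expectation M (\<lambda>\<omega>. f_lin (g \<omega>) x - f_lin (g \<omega>) (x_next \<omega>)) =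
           Gamma (real CARD('d) / 2) * Gamma (real CARD('p) / 2 + 1 / 2) /
           (Gamma (real CARD('d) / 2 + 1 / 2) * Gamma (real CARD('p) / 2))"
proof -
  interpret prob_space M by fact
  note [measurable] = \<open>g \<in> borel_measurable M\<close> \<open>B \<in> borel_measurable M\<close>
  let ?\<mu> = "distr M borel g" and ?\<nu> = "distr M borel B"
  let ?c = "Gamma (real CARD('d) / 2) * Gamma (real CARD('p) / 2 + 1 / 2) /
           (Gamma (real CARD('d) / 2 + 1 / 2) * Gamma (real CARD('p) / 2))"
  interpret \<mu>: prob_space ?\<mu> by (rule prob_space_distr) measurable
  interpret \<nu>: prob_space ?\<nu> by (rule prob_space_distr) measurable
  interpret pair_sigma_finite ?\<mu> ?\<nu> ..
  have joint: "?\<mu> \<Otimes>\<^sub>M ?\<nu> = distr M (borel \<Otimes>\<^sub>M borel) (\<lambda>\<omega>. (g \<omega>, B \<omega>))"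
    using assms(5,7,9) by (rule distr_pair_eq_pair_measure)
  have "AE X in ?\<nu>. X \<in> stiefel"
  proof (subst \<nu>.AE_in_set_eq_1)
    \<comment> \<open>The set is measurable since a non-measurable set has \<open>emeasure\<close> 0 by convention, not 1.\<close>
    show "stiefel \<in> \<nu>.events"
      using \<open>uniform_on_stiefel ?\<nu>\<close> emeasure_notin_sets[of stiefel ?\<nu>]
      by (auto simp: uniform_on_stiefel_def)
    show "\<nu>.prob stiefel = 1"
      using \<open>uniform_on_stiefel ?\<nu>\<close> by (simp add: uniform_on_stiefel_def measure_def)
  qed
  then have stiefel: "AE X in ?\<nu>. (\<integral>\<^sup>+v. ennreal (norm (v v* X)) \<partial>?\<mu>) = ennreal ?c"
    by eventually_elim (rule nn_integral_norm_vector_stiefel_mult_sphere[OF \<open>uniform_on_sphere ?\<mu>\<close>])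
  have "(\<integral>\<^sup>+\<omega>. ennreal (norm (g \<omega> v* B \<omega>)) \<partial>M) =
      (\<integral>\<^sup>+p. ennreal (norm (case p of (v, X) \<Rightarrow> v v* X)) \<partial>(?\<mu> \<Otimes>\<^sub>M ?\<nu>))"
    unfolding joint by (subst nn_integral_distr) simp_all
  also have "\<dots> = (\<integral>\<^sup>+X. \<integral>\<^sup>+v. ennreal (norm (v v* X)) \<partial>?\<mu> \<partial>?\<nu>)"
    by (subst nn_integral_snd[symmetric]) simp_all
  also have "\<dots> = (\<integral>\<^sup>+X. ennreal ?c \<partial>?\<nu>)"
    using stiefel by (rule nn_integral_cong_AE)
  also have "\<dots> = ennreal ?c"
    using \<nu>.emeasure_space_1 by simp
  finally have nn: "(\<integral>\<^sup>+\<omega>. ennreal (norm (g \<omega> v* B \<omega>)) \<partial>M) = ennreal ?c" .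
  have "(\<lambda>\<omega>. case (g \<omega>, B \<omega>) of (v, X) \<Rightarrow> v v* X) \<in> borel_measurable M"
    by measurable
  then have [measurable]: "(\<lambda>\<omega>. g \<omega> v* B \<omega>) \<in> borel_measurable M"
    by simp
  have "expectation (\<lambda>\<omega>. f_lin (g \<omega>) x - f_lin (g \<omega>) (x_next \<omega>)) =
      expectation (\<lambda>\<omega>. norm (g \<omega> v* B \<omega>))"
    using assms(10) by (intro Bochner_Integration.integral_cong) (simp_all add: mb_step_f_lin_decrease)
  also have "\<dots> = enn2real (ennreal ?c)"
    by (subst integral_eq_nn_integral) (simp_all add: nn)
  also have "\<dots> = ?c"
    by (intro enn2real_ennreal divide_nonneg_nonneg mult_nonneg_nonneg less_imp_le[OF Gamma_real_pos])
      (simp_all add: add_pos_pos)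
  finally show ?thesis .
qed

end
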